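(* Let $\tau=(T_j)_{1\le j\le n}$ be an $n$-tuple of bounded Hermitian operators on $\mathcal H$ and let $(\mathcal I,|\cdot|_{\mathcal I})$ be a normed ideal of compact operators on $\mathcal H$. Assume that the finite rank operators $\mathcal R$ are dense in $\mathcal I$ and that $k_{\mathcal I}(\tau)=C<\infty$. Let $A_m\in\mathcal R_1^+$, $m\in\mathbb N$, be such that $A_m\uparrow I$ as $m\to\infty$ and $\lim_{m\to\infty}|[A_m,\tau]|_{\mathcal I}=C$. Then $$\lim_{m\to\infty}|||A_m|||=1+C$$ and $$\lim_{m\to\infty}|||K-A_mK|||=\lim_{m\to\infty}|||K-KA_m|||=0$$ for every $K\in\mathcal K(\tau;\mathcal I)$.
   Context: $\mathcal H$ is a separable infinite-dimensional complex Hilbert space. A normed ideal $(\mathcal I,|\cdot|_{\mathcal I})$ of compact operators is a nonzero two-sided ideal of $\mathcal B(\mathcal H)$ consisting of compact operators, complete in a norm satisfying $|AXB|_{\mathcal I}\le\|A\|\,|X|_{\mathcal I}\,\|B\|$ and $|X|_{\mathcal I}=\|X\|$ for $X$ of rank one. $\mathcal R$ is the set of finite rank operators on $\mathcal H$, and $\mathcal R_1^+$ is the set of finite rank operators $A$ with $0\le A\le I$, with its natural order. $A_m\uparrow I$ means that the sequence is increasing and converges strongly to $I$. For $X\in\mathcal B(\mathcal H)$ with $[X,T_j]\in\mathcal I$ for all $j$, $|[X,\tau]|_{\mathcal I}=\max_{1\le j\le n}|[X,T_j]|_{\mathcal I}$. $\mathcal E(\tau;\mathcal I)=\{X\in\mathcal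 B(\mathcal H):[X,T_j]\in\mathcal I,\ 1\le j\le n\}$ with the norm $|||X|||=\|X\|+\max_{1\le j\le n}|[T_j,X]|_{\mathcal I}$, and $\mathcal K(\tau;\mathcal I)$ is the set of compact operators in $\mathcal E(\tau;\mathcal I)$. $k_{\mathcal I}(\tau)=\liminf_{A\in\mathcal R_1^+}\max_{1\le j\le n}|[A,T_j]|_{\mathcal I}$, the $\liminf$ being with respect to the natural order on $\mathcal R_1^+$, i.e. $\sup_{B\in\mathcal R_1^+}\inf_{A\in\mathcal R_1^+,\,A\ge B}\max_j|[A,T_j]|_{\mathcal I}$. *)

theory Defs
  imports "HOL-Analysis.Analysis"
begin

text \<open>
  Complex Hilbert spaces. The inner product is linear in its first argument, and the real
  Hilbert space structure inherited from the superclasses is the underlying one, so that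
  the norm is the one given by \<open>cinner\<close>.
\<close>

class complex_hilbert_space = real_inner + banach +
  fixes scaleC :: "complex \<Rightarrow> 'a \<Rightarrow> 'a" (infixr "*\<^sub>C" 75)
    and cinner :: "'a \<Rightarrow> 'a \<Rightarrow> complex"
  assumes scaleC_add_right: "c *\<^sub>C (x + y) = c *\<^sub>C x + c *\<^sub>C y"
    and scaleC_add_left: "(c + d) *\<^sub>C x = c *\<^sub>C x + d *\<^sub>C x"
    and scaleC_scaleC: "c *\<^sub>C d *\<^sub>C x = (c * d) *\<^sub>C x"
    and scaleR_eq_scaleC: "r *\<^sub>R x = complex_of_real r *\<^sub>C x"
    and cinner_commute: "cinner x y = cnj (cinner y x)"
    and cinner_add_left: "cinner (x + y) z = cinner x z + cinner y z"
    and cinner_scaleC_left: "cinner (c *\<^sub>C x) y = c * cinner x y"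
    and inner_eq_Re_cinner: "inner x y = Re (cinner x y)"

lemma scaleC_one: "1 *\<^sub>C x = (x :: 'a::complex_hilbert_space)"
  using scaleR_eq_scaleC[of 1 x] by simp

interpretation complex_vector:
  vector_space "scaleC :: complex \<Rightarrow> 'a \<Rightarrow> 'a::complex_hilbert_space"
  by unfold_locales (simp_all add: scaleC_add_right scaleC_add_left scaleC_scaleC scaleC_one)

lemma cinner_scaleC_right:
  "cinner x (c *\<^sub>C y) = cnj c * cinner x (y :: 'a::complex_hilbert_space)"
  by (metis cinner_commute cinner_scaleC_left complex_cnj_cnj complex_cnj_mult)

lemma norm_scaleC: "norm (c *\<^sub>C x) = cmod c * norm (x :: 'a::complex_hilbert_space)"
proof -
  have "cinner (c *\<^sub>C x) (c *\<^sub>C x) = complex_of_real ((cmod c)\<^sup>2) * cinner x x"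
    by (simp only: cinner_scaleC_left cinner_scaleC_right complex_norm_square mult_ac)
  then have "inner (c *\<^sub>C x) (c *\<^sub>C x) = (cmod c)\<^sup>2 * inner x x"
    by (simp add: inner_eq_Re_cinner)
  then show ?thesis
    by (simp add: norm_eq_sqrt_inner real_sqrt_mult)
qed

lemma bounded_linear_scaleC:
  "bounded_linear (\<lambda>x. c *\<^sub>C (x :: 'a::complex_hilbert_space))"
proof (rule bounded_linear_intro[where K = "cmod c"])
  show "c *\<^sub>C (r *\<^sub>R x) = r *\<^sub>R (c *\<^sub>C x)" for r and x :: 'a
    by (simp add: scaleR_eq_scaleC scaleC_scaleC mult.commute)
qed (simp_all add: scaleC_add_right norm_scaleC mult.commute)

lift_definition scaleC_op ::
  "complex \<Rightarrow> ('a \<Rightarrow>\<^sub>L 'a) \<Rightarrow> ('a::complex_hilbert_space \<Rightarrow>\<^sub>L 'a)"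
  is "\<lambda>c X x. c *\<^sub>C X x"
  by (rule bounded_linear_compose[OF bounded_linear_scaleC])

definition infinite_dimensional :: "'a::complex_hilbert_space itself \<Rightarrow> bool"
  where "infinite_dimensional _ \<longleftrightarrow>
    \<not> (\<exists>S :: 'a set. finite S \<and> complex_vector.span S = UNIV)"

text \<open>
  The elements of \<open>'a \<Rightarrow>\<^sub>L 'a\<close> are only real-linear, so \<open>bounded_ops\<close> singles out
  the algebra of complex-linear bounded operators.
\<close>

definition bounded_ops :: "('a::complex_hilbert_space \<Rightarrow>\<^sub>L 'a) set"
  where "bounded_ops = {X. \<forall>c x. blinfun_apply X (c *\<^sub>C x) = c *\<^sub>C blinfun_apply X x}"

definition compact_ops :: "('a::complex_hilbert_space \<Rightarrow>\<^sub>L 'a) set"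
  where "compact_ops = {X \<in> bounded_ops. compact (closure (blinfun_apply X ` cball 0 1))}"

definition finite_rank_ops :: "('a::complex_hilbert_space \<Rightarrow>\<^sub>L 'a) set"
  where "finite_rank_ops = {X \<in> bounded_ops.
    \<exists>S. finite S \<and> range (blinfun_apply X) \<subseteq> complex_vector.span S}"

definition rank_one_ops :: "('a::complex_hilbert_space \<Rightarrow>\<^sub>L 'a) set"
  where "rank_one_ops = {X \<in> bounded_ops. complex_vector.dim (range (blinfun_apply X)) = 1}"

definition hermitian :: "('a::complex_hilbert_space \<Rightarrow>\<^sub>L 'a) \<Rightarrow> bool"
  where "hermitian X \<longleftrightarrow> X \<in> bounded_ops \<and>
    (\<forall>x y. cinner (blinfun_apply X x) y = cinner x (blinfun_apply X y))"

definition positive_op :: "('a::complex_hilbert_space \<Rightarrow>\<^sub>L 'a) \<Rightarrow> bool"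
  where "positive_op X \<longleftrightarrow> hermitian X \<and> (\<forall>x. 0 \<le> Re (cinner (blinfun_apply X x) x))"

definition op_le :: "('a::complex_hilbert_space \<Rightarrow>\<^sub>L 'a) \<Rightarrow> ('a \<Rightarrow>\<^sub>L 'a) \<Rightarrow> bool"
  where "op_le X Y \<longleftrightarrow> positive_op (Y - X)"

definition R1_plus :: "('a::complex_hilbert_space \<Rightarrow>\<^sub>L 'a) set"
  where "R1_plus = {A \<in> finite_rank_ops. op_le 0 A \<and> op_le A id_blinfun}"

definition commutator ::
  "('a::complex_hilbert_space \<Rightarrow>\<^sub>L 'a) \<Rightarrow> ('a \<Rightarrow>\<^sub>L 'a) \<Rightarrow> ('a \<Rightarrow>\<^sub>L 'a)"
  where "commutator X Y = (X o\<^sub>L Y) - (Y o\<^sub>L X)"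

definition increases_strongly_to_id :: "(nat \<Rightarrow> ('a::complex_hilbert_space \<Rightarrow>\<^sub>L 'a)) \<Rightarrow> bool"
  where "increases_strongly_to_id A \<longleftrightarrow> (\<forall>l m. l \<le> m \<longrightarrow> op_le (A l) (A m)) \<and>
    (\<forall>x. (\<lambda>m. blinfun_apply (A m) x) \<longlonglongrightarrow> x)"

text \<open>
  A normed ideal is given by its underlying set \<open>I\<close> and a function \<open>nI\<close> whose values
  matter only on \<open>I\<close>. Closure of \<open>I\<close> under complex scalars follows from \<open>mult_left\<close>.
\<close>

locale normed_ideal =
  fixes I :: "('a::complex_hilbert_space \<Rightarrow>\<^sub>L 'a) set"
    and nI :: "('a \<Rightarrow>\<^sub>L 'a) \<Rightarrow> real"
  assumes subset_compact: "I \<subseteq> compact_ops"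
    and nonzero: "\<exists>X\<in>I. X \<noteq> 0"
    and add: "X \<in> I \<Longrightarrow> Y \<in> I \<Longrightarrow> X + Y \<in> I"
    and mult_left: "A \<in> bounded_ops \<Longrightarrow> X \<in> I \<Longrightarrow> A o\<^sub>L X \<in> I"
    and mult_right: "X \<in> I \<Longrightarrow> B \<in> bounded_ops \<Longrightarrow> X o\<^sub>L B \<in> I"
    and norm_nonneg: "X \<in> I \<Longrightarrow> 0 \<le> nI X"
    and norm_eq_0_iff: "X \<in> I \<Longrightarrow> nI X = 0 \<longleftrightarrow> X = 0"
    and norm_triangle: "X \<in> I \<Longrightarrow> Y \<in> I \<Longrightarrow> nI (X + Y) \<le> nI X + nI Y"
    and norm_scale: "X \<in> I \<Longrightarrow> nI (scaleC_op c X) = cmod c * nI X"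
    and complete: "\<lbrakk>\<And>m. S m \<in> I; \<And>e. 0 < e \<Longrightarrow> \<exists>N. \<forall>l\<ge>N. \<forall>m\<ge>N. nI (S l - S m) < e\<rbrakk>
        \<Longrightarrow> \<exists>X\<in>I. (\<lambda>m. nI (S m - X)) \<longlonglongrightarrow> 0"
    and norm_mult: "\<lbrakk>A \<in> bounded_ops; X \<in> I; B \<in> bounded_ops\<rbrakk>
        \<Longrightarrow> nI (A o\<^sub>L X o\<^sub>L B) \<le> norm A * nI X * norm B"
    and norm_rank_one: "X \<in> I \<Longrightarrow> X \<in> rank_one_ops \<Longrightarrow> nI X = norm X"

definition finite_rank_dense ::
  "('a::complex_hilbert_space \<Rightarrow>\<^sub>L 'a) set \<Rightarrow> (('a \<Rightarrow>\<^sub>L 'a) \<Rightarrow> real) \<Rightarrow> bool"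
  where "finite_rank_dense I nI \<longleftrightarrow> (\<forall>X\<in>I. \<forall>e>0. \<exists>F\<in>finite_rank_ops \<inter> I. nI (X - F) < e)"

text \<open>
  An \<open>n\<close>-tuple is a function on \<open>nat\<close> restricted to \<open>{1..n}\<close>. As in the definition of
  \<open>normed_ideal\<close>, the following norms are meaningful only if the commutators lie in the ideal.
\<close>

definition commutator_norm ::
  "(('a::complex_hilbert_space \<Rightarrow>\<^sub>L 'a) \<Rightarrow> real) \<Rightarrow> nat \<Rightarrow> (nat \<Rightarrow> ('a \<Rightarrow>\<^sub>L 'a)) \<Rightarrow> ('a \<Rightarrow>\<^sub>L 'a) \<Rightarrow> real"
  where "commutator_norm nI n T X = (MAX j\<in>{1..n}. nI (commutator X (T j)))"

definition E_algebra ::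
  "('a::complex_hilbert_space \<Rightarrow>\<^sub>L 'a) set \<Rightarrow> nat \<Rightarrow> (nat \<Rightarrow> ('a \<Rightarrow>\<^sub>L 'a)) \<Rightarrow> ('a \<Rightarrow>\<^sub>L 'a) set"
  where "E_algebra I n T = {X \<in> bounded_ops. \<forall>j\<in>{1..n}. commutator X (T j) \<in> I}"

definition E_norm ::
  "(('a::complex_hilbert_space \<Rightarrow>\<^sub>L 'a) \<Rightarrow> real) \<Rightarrow> nat \<Rightarrow> (nat \<Rightarrow> ('a \<Rightarrow>\<^sub>L 'a)) \<Rightarrow> ('a \<Rightarrow>\<^sub>L 'a) \<Rightarrow> real"
  where "E_norm nI n T X = norm X + (MAX j\<in>{1..n}. nI (commutator (T j) X))"

definition K_algebra ::
  "('a::complex_hilbert_space \<Rightarrow>\<^sub>L 'a) set \<Rightarrow> nat \<Rightarrow> (nat \<Rightarrow> ('a \<Rightarrow>\<^sub>L 'a)) \<Rightarrow> ('a \<Rightarrow>\<^sub>L 'a) set"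
  where "K_algebra I n T = E_algebra I n T \<inter> compact_ops"

definition quasicentral_modulus ::
  "(('a::complex_hilbert_space \<Rightarrow>\<^sub>L 'a) \<Rightarrow> real) \<Rightarrow> nat \<Rightarrow> (nat \<Rightarrow> ('a \<Rightarrow>\<^sub>L 'a)) \<Rightarrow> ereal"
  where "quasicentral_modulus nI n T =
    (SUP B\<in>R1_plus. INF A\<in>{A \<in> R1_plus. op_le B A}. ereal (commutator_norm nI n T A))"

end

theory Submission
  imports Defs
begin

text \<open>
  Put \<open>B\<^sub>m = 1 - A\<^sub>m\<close>. These are hermitian contractions tending strongly to \<open>0\<close>, so
  \<open>B\<^sub>m K\<close> and \<open>K B\<^sub>m\<close> tend to \<open>0\<close> in operator norm for compact \<open>K\<close>. A finite rank operator
  factors as \<open>F = P F = F R\<close> with finite rank projections \<open>P\<close>, \<open>R\<close>, so by density of these operators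
  \<open>B\<^sub>m Y\<close> and \<open>Y B\<^sub>m\<close> tend to \<open>0\<close> in the ideal norm for \<open>Y\<close> in the ideal. Now \<open>[T, B\<^sub>m K] = B\<^sub>m [T, K] + [A\<^sub>m, T] K\<close>, where the first summand is of this kind.
  In the second, \<open>[A\<^sub>m, T]\<close> is bounded in the ideal norm and \<open>K\<close> is a limit in operator norm of
  elements \<open>F = A\<^sub>l K\<close> of the ideal, for which \<open>[A\<^sub>m, T] F = T B\<^sub>m F - B\<^sub>m T F\<close> tends to \<open>0\<close>.
\<close>

section \<open>Real preliminaries: limits, Riesz representation, adjoints, compactness\<close>

lemma tendsto_zero_approx:
  fixes f :: "nat \<Rightarrow> real"
  assumes nonneg: "\<And>m. 0 \<le> f m"
    and approx: "\<And>e. 0 < e \<Longrightarrow> \<exists>g. g \<longlonglongrightarrow> 0 \<and> (\<forall>m. f m \<le> e + g m)"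
  shows "f \<longlonglongrightarrow> 0"
proof (rule order_tendstoI)
  fix a :: real
  assume "a < 0"
  then show "eventually (\<lambda>m. a < f m) sequentially"
    using nonneg by (intro always_eventually) (meson less_le_trans)
next
  fix a :: real
  assume a: "0 < a"
  then obtain g where g: "g \<longlonglongrightarrow> 0" "\<And>m. f m \<le> a / 2 + g m"
    using approx[of "a / 2"] by auto
  have "eventually (\<lambda>m. g m < a / 2) sequentially"
    by (rule order_tendstoD(2)[OF g(1)]) (use a in simp)
  then show "eventually (\<lambda>m. f m < a) sequentially"
  proof eventually_elim
    case (elim m)
    with g(2)[of m] show ?case by linarith
  qed
qed

text \<open>The representing vector is the minimizer of \<open>q\<close>: up to a constant,
  \<open>q x\<close> is the squared distance from \<open>x\<close> to it. Completeness supplies the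
  minimizer, and its first-order condition is the claimed identity.\<close>

lemma riesz_representation:
  fixes f :: "'a::{real_inner, banach} \<Rightarrow> real"
  assumes "bounded_linear f"
  shows "\<exists>z. \<forall>x. f x = inner x z"
proof -
  interpret f: bounded_linear f by fact
  obtain k where k: "\<And>x. norm (f x) \<le> norm x * k"
    using f.bounded by blast
  define q where "q x = (norm x)\<^sup>2 - 2 * f x" for x
  have q_lower: "- k\<^sup>2 \<le> q x" for x
  proof -
    have "f x \<le> norm x * k" using k[of x] by simp
    moreover have "0 \<le> (norm x - k)\<^sup>2" by simp
    ultimately show ?thesis
      unfolding q_def by (simp add: power2_eq_square algebra_simps)
  qed
  define d where "d = Inf (range q)"
  have bdd: "bdd_below (range q)"
    by (rule bdd_belowI[where m = "- k\<^sup>2"]) (use q_lower in auto)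
  have d_le: "d \<le> q x" for x
    unfolding d_def using bdd by (auto intro: cInf_lower)
  have "\<exists>x. q x < d + 1 / real (Suc n)" for n
  proof -
    have "Inf (range q) < d + 1 / real (Suc n)" unfolding d_def by simp
    then show ?thesis using bdd by (subst (asm) cInf_less_iff) auto
  qed
  then obtain X where X: "\<And>n. q (X n) < d + 1 / real (Suc n)" by metis
  \<comment> \<open>Parallelogram law: the linear parts of \<open>q\<close> cancel, and
    \<open>q\<close> at the midpoint is at least \<open>d\<close>. Hence a minimizing sequence is
    Cauchy.\<close>
  have midpoint: "(norm (x - y))\<^sup>2 \<le> 2 * (q x - d) + 2 * (q y - d)" for x y
  proof -
    have "(norm (x - y))\<^sup>2 = 2 * q x + 2 * q y - 4 * q ((1 / 2) *\<^sub>R (x + y))"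
      unfolding q_def f.scaleR f.add power2_norm_eq_inner
      by (simp add: inner_simps inner_commute field_simps)
    with d_le[of "(1 / 2) *\<^sub>R (x + y)"] show ?thesis by argo
  qed
  have "Cauchy X"
  proof (rule metric_CauchyI)
    fix e :: real
    assume e: "0 < e"
    then obtain N where N: "1 / real (Suc N) < e\<^sup>2 / 4"
      using nat_approx_posE[of "e\<^sup>2 / 4"] by auto
    have "dist (X i) (X j) < e" if "i \<ge> N" "j \<ge> N" for i j
    proof -
      have small: "q (X k) - d < e\<^sup>2 / 4" if "k \<ge> N" for k
      proof -
        have "1 / real (Suc k) \<le> 1 / real (Suc N)"
          using that by (intro divide_left_mono) auto
        then show ?thesis using X[of k] N by linarith
      qed
      have "(norm (X i - X j))\<^sup>2 < e\<^sup>2"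
        using midpoint[of "X i" "X j"] small[OF that(1)] small[OF that(2)] by argo
      then show ?thesis
        using e by (simp add: dist_norm power_less_imp_less_base)
    qed
    then show "\<exists>M. \<forall>m\<ge>M. \<forall>n\<ge>M. dist (X m) (X n) < e" by blast
  qed
  then obtain z where z: "X \<longlonglongrightarrow> z"
    using convergent_eq_Cauchy by blast
  have "(\<lambda>n. q (X n)) \<longlonglongrightarrow> q z"
    unfolding q_def by (intro tendsto_intros z f.tendsto)
  moreover have "(\<lambda>n. d + 1 / real (Suc n)) \<longlonglongrightarrow> d + 0"
    by (intro tendsto_add tendsto_const LIMSEQ_Suc[OF lim_1_over_n])
  ultimately have qz: "q z \<le> d"
    using X by (metis (no_types, lifting) LIMSEQ_le add.right_neutral less_imp_le)
  have "f x = inner x z" for x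
  proof -
    define s where "s = inner x z - f x"
    \<comment> \<open>Compare \<open>q\<close> at the minimizer \<open>z\<close> with
      \<open>q\<close> at its perturbation along \<open>x\<close>.\<close>
    have *: "0 \<le> t\<^sup>2 * (norm x)\<^sup>2 + 2 * t * s" for t
    proof -
      have "q (z + t *\<^sub>R x) = q z + t\<^sup>2 * (norm x)\<^sup>2 + 2 * t * s"
        unfolding q_def s_def f.scaleR f.add power2_norm_eq_inner
        by (simp add: inner_simps inner_commute power2_eq_square algebra_simps)
      with d_le[of "z + t *\<^sub>R x"] qz show ?thesis by linarith
    qed
    \<comment> \<open>The extra \<open>1\<close> keeps \<open>r\<close> positive even for
      \<open>x = 0\<close>. At \<open>t = - s / r\<close> the quadratic in \<open>t\<close> is
      negative unless \<open>s = 0\<close>.\<close>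
    define r where "r = (norm x)\<^sup>2 + 1"
    have r: "r > 0" "(norm x)\<^sup>2 = r - 1" by (simp_all add: r_def add_nonneg_pos)
    have "0 \<le> (- s / r)\<^sup>2 * (r - 1) + 2 * (- s / r) * s"
      using *[of "- s / r"] r(2) by simp
    also have "\<dots> = - (s\<^sup>2 * (r + 1) / r\<^sup>2)"
      using r(1) by (simp add: field_simps power2_eq_square)
    finally have "s\<^sup>2 * (r + 1) / r\<^sup>2 \<le> 0" by simp
    then have "s\<^sup>2 \<le> 0"
      using r(1) by (simp add: divide_le_0_iff mult_le_0_iff)
    then show ?thesis by (simp add: s_def)
  qed
  then show ?thesis by blast
qed

text \<open>Riesz representation of \<open>x \<mapsto> inner (X x) y\<close> gives the value of the
  adjoint at \<open>y\<close>; uniqueness of representing vectors gives linearity, and testing at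
  the value itself gives the bound.\<close>

lemma ex_adjoint:
  fixes X :: "'a::{real_inner, banach} \<Rightarrow>\<^sub>L 'b::real_inner"
  shows "\<exists>Y :: 'b \<Rightarrow>\<^sub>L 'a. \<forall>x y. inner (X x) y = inner x (Y y)"
proof -
  have "\<exists>z. \<forall>x. inner (X x) y = inner x z" for y
    by (intro riesz_representation bounded_linear_intros)
  then obtain g where g: "\<And>x y. inner (X x) y = inner x (g y)" by metis
  have "bounded_linear g"
  proof (rule bounded_linear_intro[where K = "norm X"])
    show "g (x + y) = g x + g y" for x y
      by (subst vector_eq_ldot[symmetric]) (simp add: inner_add_right flip: g)
    show "g (r *\<^sub>R x) = r *\<^sub>R g x" for r x
      by (subst vector_eq_ldot[symmetric]) (simp flip: g)
    show "norm (g x) \<le> norm x * norm X" for x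
    proof -
      have "norm (g x) * norm (g x) = inner (X (g x)) x"
        by (simp add: g flip: power2_norm_eq_inner power2_eq_square)
      also have "\<dots> \<le> norm (X (g x)) * norm x" by (rule norm_cauchy_schwarz)
      also have "\<dots> \<le> (norm X * norm (g x)) * norm x"
        by (intro mult_right_mono norm_blinfun) simp
      finally have "norm (g x) * norm (g x) \<le> norm (g x) * (norm x * norm X)"
        by (simp add: mult_ac)
      then show ?thesis
        by (cases "g x = 0") (simp_all)
    qed
  qed
  then show ?thesis
    using g by (intro exI[of _ "Blinfun g"]) (simp add: bounded_linear_Blinfun_apply)
qed

text \<open>For contractions, pointwise convergence to zero is uniform on totally bounded sets: on a
  cover by balls of radius \<open>e\<close>, the error is at most \<open>e\<close> plus the norm at
  the nearby centre. Summing over all centres gives a bound that depends on \<open>m\<close>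
  alone.\<close>

lemma null_sequence_compact:
  fixes B :: "nat \<Rightarrow> 'b::real_normed_vector \<Rightarrow>\<^sub>L 'c::real_normed_vector"
    and K :: "'a::real_normed_vector \<Rightarrow>\<^sub>L 'b"
  assumes contraction: "\<And>m. norm (B m) \<le> 1"
    and null: "\<And>x. (\<lambda>m. B m x) \<longlonglongrightarrow> 0"
    and compact: "compact (closure (K ` cball 0 1))"
  shows "(\<lambda>m. norm (B m o\<^sub>L K)) \<longlonglongrightarrow> 0"
proof (rule tendsto_zero_approx)
  fix e :: real
  assume e: "0 < e"
  obtain D where D: "finite D" "closure (K ` cball 0 1) \<subseteq> (\<Union>y\<in>D. ball y e)"
    using compact e unfolding compact_eq_totally_bounded by blast
  have unit: "norm (B m (K x)) \<le> e + (\<Sum>y\<in>D. norm (B m y))" if "norm x = 1" for m x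
  proof -
    have "K x \<in> closure (K ` cball 0 1)"
      using that closure_subset by fastforce
    then obtain y where y: "y \<in> D" "norm (K x - y) < e"
      using D(2) by (auto simp: dist_norm norm_minus_commute)
    have "norm (B m (K x)) = norm (B m (K x - y) + B m y)"
      by (simp add: blinfun.diff_right)
    also have "\<dots> \<le> norm (B m (K x - y)) + norm (B m y)" by (rule norm_triangle_ineq)
    also have "norm (B m (K x - y)) \<le> norm (B m) * norm (K x - y)" by (rule norm_blinfun)
    also have "\<dots> \<le> 1 * e" using contraction y(2) by (intro mult_mono) auto
    also have "norm (B m y) \<le> (\<Sum>y\<in>D. norm (B m y))"
      using y(1) D(1) by (intro member_le_sum) auto
    finally show ?thesis by simp
  qed
  have "norm (B m o\<^sub>L K) \<le> e + (\<Sum>y\<in>D. norm (B m y))" for m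
  proof (rule norm_blinfun_bound)
    show "norm ((B m o\<^sub>L K) x) \<le> (e + (\<Sum>y\<in>D. norm (B m y))) * norm x" for x
    proof (cases "x = 0")
      case False
      then show ?thesis
        using unit[of "x /\<^sub>R norm x" m] by (simp add: blinfun.scaleR_right field_simps)
    qed simp
  qed (use e in \<open>auto intro!: add_nonneg_nonneg sum_nonneg\<close>)
  moreover have "(\<lambda>m. \<Sum>y\<in>D. norm (B m y)) \<longlonglongrightarrow> 0"
    by (intro tendsto_null_sum tendsto_norm_zero null)
  ultimately show "\<exists>g. g \<longlonglongrightarrow> 0 \<and> (\<forall>m. norm (B m o\<^sub>L K) \<le> e + g m)"
    by blast
qed simp

section \<open>Complex-linear operators\<close>

lemma bounded_opsD: "X \<in> bounded_ops \<Longrightarrow> X (c *\<^sub>C x) = c *\<^sub>C X x"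
  by (simp add: bounded_ops_def)

lemma bounded_ops_id: "id_blinfun \<in> bounded_ops"
  by (simp add: bounded_ops_def)

lemma bounded_ops_zero: "0 \<in> bounded_ops"
  by (simp add: bounded_ops_def)

lemma bounded_ops_compose:
  "X \<in> bounded_ops \<Longrightarrow> Y \<in> bounded_ops \<Longrightarrow> X o\<^sub>L Y \<in> bounded_ops"
  by (simp add: bounded_ops_def)

lemma bounded_ops_add: "X \<in> bounded_ops \<Longrightarrow> Y \<in> bounded_ops \<Longrightarrow> X + Y \<in> bounded_ops"
  by (simp add: bounded_ops_def blinfun.add_left scaleC_add_right)

lemma bounded_ops_uminus: "X \<in> bounded_ops \<Longrightarrow> - X \<in> bounded_ops"
  by (simp add: bounded_ops_def blinfun.minus_left complex_vector.scale_minus_right)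

lemma bounded_ops_diff: "X \<in> bounded_ops \<Longrightarrow> Y \<in> bounded_ops \<Longrightarrow> X - Y \<in> bounded_ops"
  using bounded_ops_add[OF _ bounded_ops_uminus, of X Y] by simp

lemma cinner_add_right: "cinner x (y + z) = cinner x y + cinner x (z :: 'a::complex_hilbert_space)"
  by (metis cinner_add_left cinner_commute complex_cnj_add)

lemma cinner_zero_left: "cinner 0 (x :: 'a::complex_hilbert_space) = 0"
  using cinner_add_left[of 0 0 x] by simp

lemma cinner_diff_left: "cinner (x - y) z = cinner x z - cinner y (z :: 'a::complex_hilbert_space)"
  using cinner_add_left[of "x - y" y z] by simp

lemma cinner_self: "cinner x x = complex_of_real ((norm (x :: 'a::complex_hilbert_space))\<^sup>2)"
proof -
  have "Im (cinner x x) = 0"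
    using arg_cong[OF cinner_commute[of x x], of Im] by simp
  then show ?thesis
    by (simp add: complex_eq_iff power2_norm_eq_inner inner_eq_Re_cinner)
qed

text \<open>Multiplying \<open>x\<close> by a phase \<open>u\<close> makes the complex inner product
  real and nonnegative, which reduces the claim to the real Cauchy-Schwarz inequality.\<close>

lemma cmod_cinner_le: "cmod (cinner x y) \<le> norm x * norm (y :: 'a::complex_hilbert_space)"
proof (cases "cinner x y = 0")
  case False
  define u where "u = cnj (sgn (cinner x y))"
  have "cmod u = 1" using False by (simp add: u_def norm_sgn)
  have "cinner (u *\<^sub>C x) y = complex_of_real (cmod (cinner x y))"
    using False complex_norm_square[of "cinner x y"] unfolding u_def cinner_scaleC_left
    by (simp add: sgn_eq field_simps power2_eq_square)
  then have "cmod (cinner x y) = inner (u *\<^sub>C x) y"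
    by (simp add: inner_eq_Re_cinner)
  also have "\<dots> \<le> norm (u *\<^sub>C x) * norm y" by (rule norm_cauchy_schwarz)
  finally show ?thesis by (simp add: norm_scaleC \<open>cmod u = 1\<close>)
qed simp

lift_definition rank_one ::
  "'a \<Rightarrow> 'a \<Rightarrow> ('a::complex_hilbert_space \<Rightarrow>\<^sub>L 'a)" is "\<lambda>u v x. cinner x v *\<^sub>C u"
proof -
  fix u v :: 'a
  show "bounded_linear (\<lambda>x. cinner x v *\<^sub>C u)"
  proof (rule bounded_linear_intro[where K = "norm v * norm u"])
    show "norm (cinner x v *\<^sub>C u) \<le> norm x * (norm v * norm u)" for x
      using mult_right_mono[OF cmod_cinner_le[of x v], of "norm u"]
      by (simp add: norm_scaleC mult.assoc)
  qed (simp_all add: cinner_add_left scaleC_add_left scaleR_eq_scaleC cinner_scaleC_left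
      scaleC_scaleC)
qed

lemma rank_one_bounded_ops: "rank_one u v \<in> bounded_ops"
  by (simp add: bounded_ops_def rank_one.rep_eq cinner_scaleC_left scaleC_scaleC)

lemma hermitian_inner: "hermitian X \<Longrightarrow> inner (X x) y = inner x (X y)"
  by (simp add: hermitian_def inner_eq_Re_cinner)

text \<open>Elementary substitute for square roots of operators: with \<open>y = X x\<close>,
  positivity at \<open>x - y\<close> bounds \<open>2 * inner y y\<close> by
  \<open>inner (X x) x + inner (X y) y\<close>, hence by
  \<open>inner x x + inner y y\<close>.\<close>

lemma positive_contraction_norm_le:
  assumes "hermitian X"
    and nonneg: "\<And>x. 0 \<le> inner (X x) x"
    and le: "\<And>x. inner (X x) x \<le> inner x x"
  shows "norm X \<le> 1"
proof (rule norm_blinfun_bound)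
  fix x
  let ?y = "X x"
  have "inner (X ?y) x = inner ?y ?y"
    using assms(1) by (simp add: hermitian_inner)
  moreover have "inner (X x) ?y = inner ?y ?y" ..
  moreover have "0 \<le> inner (X (x - ?y)) (x - ?y)" by (rule nonneg)
  ultimately have "0 \<le> inner (X x) x - 2 * inner ?y ?y + inner (X ?y) ?y"
    by (simp add: blinfun.diff_right inner_diff_left inner_diff_right)
  with le[of x] le[of ?y] have "inner ?y ?y \<le> inner x x" by linarith
  then show "norm ?y \<le> 1 * norm x" by (simp add: norm_le)
qed simp

text \<open>The adjoint for the real part of the inner product is already the complex one: a scalar
  \<open>c\<close> crosses the inner product as \<open>cnj c\<close>, commutes with
  \<open>X\<close>, and crosses back.\<close>

lemma ex_adjoint_bounded_ops:
  assumes "X \<in> bounded_ops"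
  shows "\<exists>Y\<in>bounded_ops. \<forall>x y. inner (X x) y = inner x (Y y)"
proof -
  obtain Y :: "'a \<Rightarrow>\<^sub>L 'a" where Y: "\<And>x y. inner (X x) y = inner x (Y y)"
    using ex_adjoint[of X] by blast
  have "inner x (Y (c *\<^sub>C y)) = inner x (c *\<^sub>C Y y)" for c x y
  proof -
    have "inner x (Y (c *\<^sub>C y)) = inner (X (cnj c *\<^sub>C x)) y"
      unfolding Y[symmetric] bounded_opsD[OF assms]
      by (simp add: inner_eq_Re_cinner cinner_scaleC_left cinner_scaleC_right)
    also have "\<dots> = inner x (c *\<^sub>C Y y)"
      unfolding Y by (simp add: inner_eq_Re_cinner cinner_scaleC_left cinner_scaleC_right)
    finally show ?thesis .
  qed
  then have "Y \<in> bounded_ops"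
    unfolding bounded_ops_def mem_Collect_eq by (metis vector_eq_ldot)
  with Y show ?thesis by blast
qed

lemma compact_ops_compose_left:
  assumes "X \<in> bounded_ops" "K \<in> compact_ops"
  shows "X o\<^sub>L K \<in> compact_ops"
proof -
  have "compact (X ` closure (K ` cball 0 1))"
    using assms(2) by (intro compact_continuous_image linear_continuous_on blinfun.bounded_linear_right)
      (simp add: compact_ops_def)
  moreover have "(X o\<^sub>L K) ` cball 0 1 \<subseteq> X ` closure (K ` cball 0 1)"
    using closure_subset[of "K ` cball 0 1"] by auto
  ultimately have "compact (closure ((X o\<^sub>L K) ` cball 0 1))"
    by (metis closure_minimal closed_closure compact_imp_closed compact_Int_closed inf.absorb_iff2)
  then show ?thesis
    using assms by (simp add: compact_ops_def bounded_ops_compose)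
qed

section \<open>Finite rank operators in a normed ideal\<close>

context normed_ideal
begin

lemma bounded: "X \<in> I \<Longrightarrow> X \<in> bounded_ops"
  using subset_compact by (auto simp: compact_ops_def)

lemma uminus: "X \<in> I \<Longrightarrow> - X \<in> I"
  using mult_left[OF bounded_ops_uminus[OF bounded_ops_id], of X]
  by (metis blinfun_apply_id_blinfun blinfun_apply_blinfun_compose blinfun_eqI blinfun.minus_left)

lemma diff: "X \<in> I \<Longrightarrow> Y \<in> I \<Longrightarrow> X - Y \<in> I"
  using add[OF _ uminus, of X Y] by simp

lemma zero: "0 \<in> I"
  using nonzero diff by fastforce

lemma norm_uminus: "X \<in> I \<Longrightarrow> nI (- X) = nI X"
proof -
  have "scaleC_op (- 1) X = - X"
    by (rule blinfun_eqI)
      (simp add: scaleC_op.rep_eq blinfun.minus_left complex_vector.scale_minus_left scaleC_one)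
  then show "X \<in> I \<Longrightarrow> nI (- X) = nI X"
    using norm_scale[of X "- 1"] by simp
qed

lemma norm_diff: "X \<in> I \<Longrightarrow> Y \<in> I \<Longrightarrow> nI (X - Y) \<le> nI X + nI Y"
  using norm_triangle[OF _ uminus, of X Y] by (simp add: norm_uminus)

lemma norm_compose_left: "Y \<in> bounded_ops \<Longrightarrow> X \<in> I \<Longrightarrow> nI (Y o\<^sub>L X) \<le> norm Y * nI X"
proof -
  assume *: "Y \<in> bounded_ops" "X \<in> I"
  have "nI (Y o\<^sub>L X o\<^sub>L id_blinfun) \<le> norm Y * nI X * norm (id_blinfun :: 'a \<Rightarrow>\<^sub>L 'a)"
    using * by (intro norm_mult bounded_ops_id)
  also have "\<dots> \<le> norm Y * nI X * 1"
    using * by (intro mult_left_mono norm_blinfun_id_le) (simp add: norm_nonneg)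
  finally show ?thesis by (simp add: blinfun_eqI[of "Y o\<^sub>L X o\<^sub>L id_blinfun" "Y o\<^sub>L X"])
qed

lemma norm_compose_right: "X \<in> I \<Longrightarrow> Y \<in> bounded_ops \<Longrightarrow> nI (X o\<^sub>L Y) \<le> nI X * norm Y"
proof -
  assume *: "X \<in> I" "Y \<in> bounded_ops"
  have "nI (id_blinfun o\<^sub>L X o\<^sub>L Y) \<le> norm (id_blinfun :: 'a \<Rightarrow>\<^sub>L 'a) * nI X * norm Y"
    using * by (intro norm_mult bounded_ops_id)
  also have "\<dots> \<le> 1 * nI X * norm Y"
    using * by (intro mult_right_mono norm_blinfun_id_le) (simp_all add: norm_nonneg)
  finally show ?thesis by (simp add: blinfun_eqI[of "id_blinfun o\<^sub>L X o\<^sub>L Y" "X o\<^sub>L Y"])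
qed

text \<open>A nonzero ideal contains every rank one operator, since each is obtained by multiplying
  a fixed nonzero \<open>X\<close> by rank one operators on both sides.\<close>

lemma rank_one_mem: "rank_one u v \<in> I"
proof -
  obtain X where X: "X \<in> I" "X \<noteq> 0" using nonzero by blast
  then obtain x where x: "X x \<noteq> 0" by (metis blinfun_eqI zero_blinfun.rep_eq)
  \<comment> \<open>Scaled so that the middle factor \<open>cinner (X x) y\<close> of the triple
    product equals 1.\<close>
  define y where "y = (1 / (norm (X x))\<^sup>2) *\<^sub>R X x"
  have "cinner (X x) y = 1"
    using x by (simp add: y_def scaleR_eq_scaleC cinner_scaleC_right cinner_self)
  then have "rank_one u v = rank_one u y o\<^sub>L X o\<^sub>L rank_one x v"
    by (intro blinfun_eqI)
      (simp add: rank_one.rep_eq bounded_opsD[OF bounded[OF X(1)]] cinner_scaleC_left)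
  then show ?thesis
    using X(1) by (simp add: mult_left mult_right rank_one_bounded_ops)
qed

text \<open>Gram-Schmidt: when \<open>v\<close> is added, the projection grows by the rank one
  projection \<open>Q\<close> onto the component \<open>w\<close> of \<open>v\<close> orthogonal to
  the old span. Membership in \<open>I\<close> follows along the way, because \<open>Q\<close> has
  rank one.\<close>

lemma ex_span_projection:
  assumes "finite S"
  shows "\<exists>P\<in>I. hermitian P \<and> range P \<subseteq> complex_vector.span S \<and>
    (\<forall>x\<in>complex_vector.span S. P x = x)"
  using assms
proof (induction S)
  case empty
  have "hermitian 0"
    by (metis hermitian_def bounded_ops_zero zero_blinfun.rep_eq cinner_zero_left cinner_commute
        complex_cnj_zero)
  then show ?case by (intro bexI[OF _ zero]) auto
next
  case (insert v S)
  let ?span = complex_vector.span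
  from insert.IH obtain P where P: "P \<in> I" "hermitian P" "range P \<subseteq> ?span S"
    and P_span: "\<And>x. x \<in> ?span S \<Longrightarrow> P x = x" by blast
  have sub: "?span S \<subseteq> ?span (insert v S)"
    by (intro complex_vector.span_mono) auto
  define w where "w = v - P v"
  show ?case
  proof (cases "w = 0")
    case True
    then have "v \<in> ?span S" using P(3) by (auto simp: w_def)
    then have "?span (insert v S) = ?span S" by (rule complex_vector.span_redundant)
    then show ?thesis using P P_span by auto
  next
    case False
    have "P w = 0"
      using P(3) P_span[of "P v"] by (simp add: w_def blinfun.diff_right image_subset_iff)
    define r where "r = complex_of_real (1 / (norm w)\<^sup>2)"
    define Q where "Q = rank_one (r *\<^sub>C w) w"
    have Q: "Q x = (cinner x w * r) *\<^sub>C w" for x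
      by (simp add: Q_def rank_one.rep_eq scaleC_scaleC)
    have "Q \<in> I" unfolding Q_def by (rule rank_one_mem)
    have w_mem: "w \<in> ?span (insert v S)"
      unfolding w_def
      by (intro complex_vector.span_diff complex_vector.span_base[of v]) (use sub P(3) in auto)
    have herm: "hermitian (P + Q)"
    proof -
      have "cinner (Q x) y = cinner x (Q y)" for x y
        using cinner_commute[of w y]
        by (simp add: Q r_def cinner_scaleC_left cinner_scaleC_right)
      then show ?thesis
        using P(2) bounded[OF \<open>Q \<in> I\<close>]
        by (simp add: hermitian_def bounded_ops_add blinfun.add_left cinner_add_left cinner_add_right)
    qed
    have range: "range (P + Q) \<subseteq> ?span (insert v S)"
      using P(3) sub w_mem
      by (auto simp: blinfun.add_left Q intro!: complex_vector.span_add complex_vector.span_scale)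
    \<comment> \<open>On the old span \<open>x = P x\<close>, so moving \<open>P\<close> across the
      inner product leaves \<open>P w = 0\<close>.\<close>
    have Q_span: "Q x = 0" if "x \<in> ?span S" for x
    proof -
      have "cinner (P x) w = cinner x (P w)" using P(2) by (simp add: hermitian_def)
      then show ?thesis
        using P_span[OF that] cinner_zero_left[of x] cinner_commute[of x 0]
        by (simp add: Q \<open>P w = 0\<close>)
    qed
    \<comment> \<open>Here \<open>v = w + P v\<close>, and \<open>P v\<close> is orthogonal to
      \<open>w\<close>.\<close>
    have "cinner v w = cinner w w"
    proof -
      have "cinner (P v) w = cinner v (P w)" using P(2) by (simp add: hermitian_def)
      then have "cinner (P v) w = 0"
        using cinner_zero_left[of v] cinner_commute[of v 0] by (simp add: \<open>P w = 0\<close>)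
      then have "cinner w w = cinner v w"
        by (subst (1) w_def) (simp add: cinner_diff_left)
      then show ?thesis ..
    qed
    then have "Q v = w"
      using False by (simp add: Q r_def cinner_self scaleC_one flip: of_real_mult)
    then have PQ_v: "(P + Q) v = v" by (simp add: blinfun.add_left w_def)
    have "(P + Q) x = x" if x: "x \<in> ?span (insert v S)" for x
    proof -
      obtain k where k: "x - k *\<^sub>C v \<in> ?span S"
        using x complex_vector.span_breakdown_eq by blast
      have "(P + Q) x = (P + Q) (x - k *\<^sub>C v) + k *\<^sub>C (P + Q) v"
        using bounded_opsD[OF bounded[OF add[OF P(1) \<open>Q \<in> I\<close>]], of k v]
        by (simp add: blinfun.diff_right)
      also have "\<dots> = x"
        unfolding PQ_v using P_span[OF k] Q_span[OF k] by (simp add: blinfun.add_left)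
      finally show ?thesis .
    qed
    with add[OF P(1) \<open>Q \<in> I\<close>] herm range show ?thesis by blast
  qed
qed

lemma finite_rank_left_unit:
  assumes "F \<in> finite_rank_ops"
  shows "\<exists>P\<in>I. P o\<^sub>L F = F"
proof -
  obtain S where S: "finite S" "range F \<subseteq> complex_vector.span S"
    using assms by (auto simp: finite_rank_ops_def)
  with ex_span_projection[OF S(1)] obtain P where "P \<in> I"
    "\<And>x. x \<in> complex_vector.span S \<Longrightarrow> P x = x" by blast
  with S(2) show ?thesis
    by (intro bexI[of _ P] blinfun_eqI) auto
qed

lemma finite_rank_right_unit:
  assumes "F \<in> finite_rank_ops"
  shows "\<exists>P\<in>I. F o\<^sub>L P = F"
proof -
  have F: "F \<in> bounded_ops" using assms by (simp add: finite_rank_ops_def)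
  obtain S where S: "finite S" "range F \<subseteq> complex_vector.span S"
    using assms by (auto simp: finite_rank_ops_def)
  obtain P where P: "hermitian P" "range P \<subseteq> complex_vector.span S"
    "\<And>x. x \<in> complex_vector.span S \<Longrightarrow> P x = x"
    using ex_span_projection[OF S(1)] by blast
  obtain G where G: "G \<in> bounded_ops" "\<And>x y. inner (F x) y = inner x (G y)"
    using ex_adjoint_bounded_ops[OF F] by blast
  have GP: "G (P y) = G y" for y
  proof -
    have "inner x (G (P y)) = inner x (G y)" for x
    proof -
      have "inner x (G (P y)) = inner (P (F x)) y"
        by (simp add: hermitian_inner[OF P(1)] flip: G(2))
      also have "P (F x) = F x" using S(2) by (intro P(3)) auto
      finally show ?thesis by (simp add: G(2))
    qed
    then show ?thesis by (metis vector_eq_ldot)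
  qed
  have G_span: "G y \<in> complex_vector.span (G ` S)" if "y \<in> complex_vector.span S" for y
    using that
  proof (induction rule: complex_vector.span_induct_alt)
    case base
    show ?case by (simp add: complex_vector.span_zero)
  next
    case (step c x y)
    then show ?case
      unfolding blinfun.add_right bounded_opsD[OF G(1)]
      by (intro complex_vector.span_add complex_vector.span_scale complex_vector.span_base[of "G x"])
        auto
  qed
  obtain R where R: "R \<in> I" "hermitian R"
    "\<And>x. x \<in> complex_vector.span (G ` S) \<Longrightarrow> R x = x"
    using ex_span_projection[of "G ` S"] S(1) by blast
  have "F (R x) = F x" for x
  proof -
    have "inner (F (R x)) y = inner (F x) y" for y
    proof -
      have "R (G y) = G y"
        using R(3) G_span[of "P y"] P(2) by (simp add: GP image_subset_iff)
      then show ?thesis by (simp add: G(2) hermitian_inner[OF R(2)])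
    qed
    then show ?thesis by (metis vector_eq_rdot)
  qed
  then show ?thesis
    using R(1) by (intro bexI[of _ R] blinfun_eqI) auto
qed

lemma finite_rank_mem: "F \<in> finite_rank_ops \<Longrightarrow> F \<in> I"
  using finite_rank_left_unit mult_right by (metis (no_types, lifting) finite_rank_ops_def mem_Collect_eq)

end

section \<open>Approximate units\<close>

locale ideal_approximate_unit = normed_ideal I nI
  for I :: "('a::complex_hilbert_space \<Rightarrow>\<^sub>L 'a) set" and nI +
  fixes A :: "nat \<Rightarrow> ('a \<Rightarrow>\<^sub>L 'a)"
  assumes dense: "finite_rank_dense I nI"
    and R1: "A m \<in> R1_plus"
    and strong: "(\<lambda>m. A m x) \<longlonglongrightarrow> x"
begin

definition B :: "nat \<Rightarrow> ('a \<Rightarrow>\<^sub>L 'a)"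
  where "B m = id_blinfun - A m"

lemma A_finite_rank: "A m \<in> finite_rank_ops"
  using R1 by (simp add: R1_plus_def)

lemma A_mem: "A m \<in> I"
  by (rule finite_rank_mem[OF A_finite_rank])

lemma A_bounded: "A m \<in> bounded_ops"
  by (rule bounded[OF A_mem])

lemma B_bounded: "B m \<in> bounded_ops"
  unfolding B_def by (intro bounded_ops_diff bounded_ops_id A_bounded)

lemma B_hermitian: "hermitian (B m)"
  using R1[of m] by (simp add: R1_plus_def op_le_def positive_op_def B_def)

text \<open>\<open>A m\<close> and \<open>B m\<close> are positive and add up to the identity, so
  the quadratic form of each is bounded by \<open>inner x x\<close>.\<close>

lemma
  shows norm_A_le: "norm (A m) \<le> 1"
    and norm_B_le: "norm (B m) \<le> 1"
proof -
  have A: "hermitian (A m)" "0 \<le> inner (A m x) x" for x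
    using R1[of m] by (auto simp: R1_plus_def op_le_def positive_op_def inner_eq_Re_cinner)
  have B: "0 \<le> inner (B m x) x" for x
    using R1[of m] by (auto simp: R1_plus_def op_le_def positive_op_def inner_eq_Re_cinner B_def)
  have split: "inner (A m x) x + inner (B m x) x = inner x x" for x
    by (simp add: B_def blinfun.diff_left inner_diff_left)
  show "norm (A m) \<le> 1"
    using A B split by (intro positive_contraction_norm_le) (auto, smt (verit))
  show "norm (B m) \<le> 1"
    using A B split B_hermitian by (intro positive_contraction_norm_le) (auto, smt (verit))
qed

lemma B_null: "(\<lambda>m. B m x) \<longlonglongrightarrow> 0"
  using tendsto_diff[OF tendsto_const[of x] strong[of x]] by (simp add: B_def blinfun.diff_left)

lemma B_compact_left: "K \<in> compact_ops \<Longrightarrow> (\<lambda>m. norm (B m o\<^sub>L K)) \<longlonglongrightarrow> 0"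
  by (intro null_sequence_compact norm_B_le B_null) (simp add: compact_ops_def)

text \<open>With \<open>G\<close> the adjoint of \<open>K\<close>, one has \<open>\<parallel>K B\<^sub>m x\<parallel>\<^sup>2 = \<langle>B\<^sub>m x, G K B\<^sub>m x\<rangle>\<close>, and \<open>G K\<close> is compact.\<close>

lemma B_compact_right:
  assumes "K \<in> compact_ops"
  shows "(\<lambda>m. norm (K o\<^sub>L B m)) \<longlonglongrightarrow> 0"
proof -
  have "K \<in> bounded_ops" using assms by (simp add: compact_ops_def)
  then obtain G where G: "G \<in> bounded_ops" "\<And>x y. inner (K x) y = inner x (G y)"
    using ex_adjoint_bounded_ops by blast
  have bound: "norm (K o\<^sub>L B m) \<le> sqrt (norm (B m o\<^sub>L (G o\<^sub>L K)))" for m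
  proof (rule norm_blinfun_bound)
    fix x
    let ?n = "norm (B m o\<^sub>L (G o\<^sub>L K))"
    have "norm (B m x) \<le> norm x"
      using norm_blinfun[of "B m" x] mult_right_mono[OF norm_B_le[of m], of "norm x"] by simp
    then have Bx: "norm ((B m o\<^sub>L (G o\<^sub>L K)) (B m x)) \<le> ?n * norm x"
      by (rule order_trans[OF norm_blinfun mult_left_mono]) simp
    have "norm (K (B m x)) ^ 2 = inner (B m x) (G (K (B m x)))"
      by (simp only: power2_norm_eq_inner G(2))
    also have "\<dots> = inner x ((B m o\<^sub>L (G o\<^sub>L K)) (B m x))"
      by (simp only: hermitian_inner[OF B_hermitian] blinfun_apply_blinfun_compose)
    also have "\<dots> \<le> norm x * norm ((B m o\<^sub>L (G o\<^sub>L K)) (B m x))" by (rule norm_cauchy_schwarz)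
    also have "\<dots> \<le> norm x * (?n * norm x)" by (rule mult_left_mono[OF Bx]) simp
    also have "\<dots> = (sqrt ?n * norm x)\<^sup>2"
      by (simp add: power_mult_distrib) (simp add: power2_eq_square)
    finally have "norm (K (B m x)) \<le> sqrt ?n * norm x"
      by (rule power2_le_imp_le) simp
    then show "norm ((K o\<^sub>L B m) x) \<le> sqrt ?n * norm x" by simp
  qed simp
  have "(\<lambda>m. sqrt (norm (B m o\<^sub>L (G o\<^sub>L K)))) \<longlonglongrightarrow> sqrt 0"
    by (rule tendsto_real_sqrt[OF B_compact_left[OF compact_ops_compose_left[OF G(1) assms]]])
  then have "(\<lambda>m. sqrt (norm (B m o\<^sub>L (G o\<^sub>L K)))) \<longlonglongrightarrow> 0" by simp
  then show ?thesis
    by (rule Lim_null_comparison[rotated]) (simp add: bound)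
qed

section \<open>Convergence in the ideal norm\<close>

lemma B_ideal_left:
  assumes Y: "Y \<in> I"
  shows "(\<lambda>m. nI (B m o\<^sub>L Y)) \<longlonglongrightarrow> 0"
proof (rule tendsto_zero_approx)
  show "0 \<le> nI (B m o\<^sub>L Y)" for m
    by (intro norm_nonneg mult_left B_bounded Y)
  fix e :: real
  assume "0 < e"
  then obtain F where F: "F \<in> finite_rank_ops" "F \<in> I" "nI (Y - F) < e"
    using dense Y by (auto simp: finite_rank_dense_def)
  obtain P where P: "P \<in> I" "P o\<^sub>L F = F" using finite_rank_left_unit[OF F(1)] by blast
  then have PF: "P (F x) = F x" for x by (metis blinfun_apply_blinfun_compose)
  have "nI (B m o\<^sub>L Y) \<le> e + norm (B m o\<^sub>L P) * nI F" for m
  proof -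
    \<comment> \<open>The left unit \<open>P\<close> of \<open>F\<close> trades the ideal norm for
      the operator norm: \<open>B m\<close> acts on the compact \<open>P\<close>, and
      \<open>nI F\<close> is a fixed factor.\<close>
    have "B m o\<^sub>L Y = (B m o\<^sub>L (Y - F)) + (B m o\<^sub>L P o\<^sub>L F)"
      by (rule blinfun_eqI) (simp add: PF blinfun.diff_left blinfun.diff_right blinfun.add_left)
    also have "nI \<dots> \<le> nI (B m o\<^sub>L (Y - F)) + nI (B m o\<^sub>L P o\<^sub>L F)"
      by (intro norm_triangle mult_left diff bounded_ops_compose B_bounded bounded P(1) Y F(2))
    also have "nI (B m o\<^sub>L (Y - F)) \<le> norm (B m) * nI (Y - F)"
      by (intro norm_compose_left diff B_bounded Y F(2))
    also have "\<dots> \<le> 1 * e"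
      using F(3) norm_nonneg[OF diff[OF Y F(2)]] norm_B_le by (intro mult_mono) auto
    also have "nI (B m o\<^sub>L P o\<^sub>L F) \<le> norm (B m o\<^sub>L P) * nI F"
      by (intro norm_compose_left bounded_ops_compose B_bounded bounded P(1) F(2))
    finally show ?thesis by simp
  qed
  moreover have "(\<lambda>m. norm (B m o\<^sub>L P) * nI F) \<longlonglongrightarrow> 0"
    using P(1) subset_compact by (intro tendsto_mult_left_zero B_compact_left) auto
  ultimately show "\<exists>g. g \<longlonglongrightarrow> 0 \<and> (\<forall>m. nI (B m o\<^sub>L Y) \<le> e + g m)" by blast
qed

text \<open>Mirror image of \<open>B_ideal_left\<close>, with a right unit of \<open>F\<close> and
  \<open>B_compact_right\<close>.\<close>

lemma B_ideal_right:
  assumes Y: "Y \<in> I"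
  shows "(\<lambda>m. nI (Y o\<^sub>L B m)) \<longlonglongrightarrow> 0"
proof (rule tendsto_zero_approx)
  show "0 \<le> nI (Y o\<^sub>L B m)" for m
    by (intro norm_nonneg mult_right B_bounded Y)
  fix e :: real
  assume "0 < e"
  then obtain F where F: "F \<in> finite_rank_ops" "F \<in> I" "nI (Y - F) < e"
    using dense Y by (auto simp: finite_rank_dense_def)
  obtain P where P: "P \<in> I" "F o\<^sub>L P = F" using finite_rank_right_unit[OF F(1)] by blast
  then have FP: "F (P x) = F x" for x by (metis blinfun_apply_blinfun_compose)
  have "nI (Y o\<^sub>L B m) \<le> e + nI F * norm (P o\<^sub>L B m)" for m
  proof -
    have "Y o\<^sub>L B m = ((Y - F) o\<^sub>L B m) + (F o\<^sub>L (P o\<^sub>L B m))"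
      by (rule blinfun_eqI) (simp add: FP blinfun.diff_left blinfun.add_left)
    also have "nI \<dots> \<le> nI ((Y - F) o\<^sub>L B m) + nI (F o\<^sub>L (P o\<^sub>L B m))"
      by (intro norm_triangle mult_right diff bounded_ops_compose B_bounded bounded P(1) Y F(2))
    also have "nI ((Y - F) o\<^sub>L B m) \<le> nI (Y - F) * norm (B m)"
      by (intro norm_compose_right diff B_bounded Y F(2))
    also have "\<dots> \<le> e * 1"
      using F(3) norm_nonneg[OF diff[OF Y F(2)]] norm_B_le by (intro mult_mono) auto
    also have "nI (F o\<^sub>L (P o\<^sub>L B m)) \<le> nI F * norm (P o\<^sub>L B m)"
      by (intro norm_compose_right bounded_ops_compose B_bounded bounded P(1) F(2))
    finally show ?thesis by simp
  qed
  moreover have "(\<lambda>m. nI F * norm (P o\<^sub>L B m)) \<longlonglongrightarrow> 0"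
    using P(1) subset_compact by (intro tendsto_mult_right_zero B_compact_right) auto
  ultimately show "\<exists>g. g \<longlonglongrightarrow> 0 \<and> (\<forall>m. nI (Y o\<^sub>L B m) \<le> e + g m)" by blast
qed

section \<open>Commutators with the approximate unit\<close>

lemma commutator_mem:
  assumes "T \<in> bounded_ops"
  shows "commutator (A m) T \<in> I"
  unfolding commutator_def by (intro diff mult_left mult_right A_mem assms)

text \<open>A compact \<open>K\<close> may lie outside \<open>I\<close>, so it is split into
  \<open>A l o\<^sub>L K\<close>, which lies in \<open>I\<close>, and
  \<open>B l o\<^sub>L K\<close>, which is small in operator norm. The uniform bound
  \<open>M\<close> lets \<open>l\<close> be chosen independently of \<open>m\<close>.\<close>

lemma commutator_compact_left:
  assumes T: "T \<in> bounded_ops" and K: "K \<in> compact_ops"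
    and M: "\<And>m. nI (commutator (A m) T) \<le> M"
  shows "(\<lambda>m. nI (commutator (A m) T o\<^sub>L K)) \<longlonglongrightarrow> 0"
proof (rule tendsto_zero_approx)
  have K': "K \<in> bounded_ops" using K by (simp add: compact_ops_def)
  show "0 \<le> nI (commutator (A m) T o\<^sub>L K)" for m
    by (intro norm_nonneg mult_right commutator_mem T K')
  fix e :: real
  assume e: "0 < e"
  have "(\<lambda>l. M * norm (B l o\<^sub>L K)) \<longlonglongrightarrow> 0"
    by (intro tendsto_mult_right_zero B_compact_left K)
  from order_tendstoD(2)[OF this e] obtain l where l: "M * norm (B l o\<^sub>L K) < e"
    by (meson eventually_sequentially order_refl)
  define F where "F = A l o\<^sub>L K"
  have F: "F \<in> I" unfolding F_def by (intro mult_right A_mem K')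
  let ?g = "\<lambda>m. norm T * nI (B m o\<^sub>L F) + nI (B m o\<^sub>L (T o\<^sub>L F))"
  have "nI (commutator (A m) T o\<^sub>L K) \<le> e + ?g m" for m
  proof -
    let ?C = "commutator (A m) T"
    \<comment> \<open>Uses \<open>K = B l K + F\<close> and \<open>[A m, T] = T B m - B m T\<close>,
      the identity part of \<open>B m\<close> commuting with \<open>T\<close>.\<close>
    have "?C o\<^sub>L K = (?C o\<^sub>L (B l o\<^sub>L K)) + ((T o\<^sub>L (B m o\<^sub>L F)) - (B m o\<^sub>L (T o\<^sub>L F)))"
      by (rule blinfun_eqI)
        (simp add: F_def B_def commutator_def blinfun.diff_left blinfun.diff_right
          blinfun.add_left blinfun.add_right)
    also have "nI \<dots> \<le> nI (?C o\<^sub>L (B l o\<^sub>L K)) + nI ((T o\<^sub>L (B m o\<^sub>L F)) - (B m o\<^sub>L (T o\<^sub>L F)))"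
      by (intro norm_triangle mult_left mult_right diff bounded_ops_compose commutator_mem
          B_bounded T K' F)
    also have "nI ((T o\<^sub>L (B m o\<^sub>L F)) - (B m o\<^sub>L (T o\<^sub>L F)))
        \<le> nI (T o\<^sub>L (B m o\<^sub>L F)) + nI (B m o\<^sub>L (T o\<^sub>L F))"
      by (intro norm_diff mult_left B_bounded T F)
    also have "nI (T o\<^sub>L (B m o\<^sub>L F)) \<le> norm T * nI (B m o\<^sub>L F)"
      by (intro norm_compose_left mult_left B_bounded T F)
    also have "nI (?C o\<^sub>L (B l o\<^sub>L K)) \<le> nI ?C * norm (B l o\<^sub>L K)"
      by (intro norm_compose_right bounded_ops_compose commutator_mem B_bounded T K')
    also have "\<dots> \<le> M * norm (B l o\<^sub>L K)" by (intro mult_right_mono M) simp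
    finally show ?thesis using l by simp
  qed
  moreover have "?g \<longlonglongrightarrow> 0"
    by (intro tendsto_add_zero tendsto_mult_right_zero B_ideal_left mult_left T F)
  ultimately show "\<exists>g. g \<longlonglongrightarrow> 0 \<and> (\<forall>m. nI (commutator (A m) T o\<^sub>L K) \<le> e + g m)"
    by blast
qed

text \<open>The same argument with all products reversed; here \<open>F = K A l\<close>.\<close>

lemma commutator_compact_right:
  assumes T: "T \<in> bounded_ops" and K: "K \<in> compact_ops"
    and M: "\<And>m. nI (commutator (A m) T) \<le> M"
  shows "(\<lambda>m. nI (K o\<^sub>L commutator (A m) T)) \<longlonglongrightarrow> 0"
proof (rule tendsto_zero_approx)
  have K': "K \<in> bounded_ops" using K by (simp add: compact_ops_def)
  show "0 \<le> nI (K o\<^sub>L commutator (A m) T)" for m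
    by (intro norm_nonneg mult_left commutator_mem T K')
  fix e :: real
  assume e: "0 < e"
  have "(\<lambda>l. norm (K o\<^sub>L B l) * M) \<longlonglongrightarrow> 0"
    by (intro tendsto_mult_left_zero B_compact_right K)
  from order_tendstoD(2)[OF this e] obtain l where l: "norm (K o\<^sub>L B l) * M < e"
    by (meson eventually_sequentially order_refl)
  define F where "F = K o\<^sub>L A l"
  have F: "F \<in> I" unfolding F_def by (intro mult_left A_mem K')
  let ?g = "\<lambda>m. nI ((F o\<^sub>L T) o\<^sub>L B m) + nI (F o\<^sub>L B m) * norm T"
  have "nI (K o\<^sub>L commutator (A m) T) \<le> e + ?g m" for m
  proof -
    let ?C = "commutator (A m) T"
    have "K o\<^sub>L ?C = ((K o\<^sub>L B l) o\<^sub>L ?C) + (((F o\<^sub>L T) o\<^sub>L B m) - ((F o\<^sub>L B m) o\<^sub>L T))"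
      by (rule blinfun_eqI)
        (simp add: F_def B_def commutator_def blinfun.diff_left blinfun.diff_right
          blinfun.add_left blinfun.add_right)
    also have "nI \<dots> \<le> nI ((K o\<^sub>L B l) o\<^sub>L ?C) + nI (((F o\<^sub>L T) o\<^sub>L B m) - ((F o\<^sub>L B m) o\<^sub>L T))"
      by (intro norm_triangle diff mult_left[OF _ commutator_mem] mult_right bounded_ops_compose
          B_bounded T K' F)
    also have "nI (((F o\<^sub>L T) o\<^sub>L B m) - ((F o\<^sub>L B m) o\<^sub>L T))
        \<le> nI ((F o\<^sub>L T) o\<^sub>L B m) + nI ((F o\<^sub>L B m) o\<^sub>L T)"
      by (intro norm_diff mult_right B_bounded T F)
    also have "nI ((F o\<^sub>L B m) o\<^sub>L T) \<le> nI (F o\<^sub>L B m) * norm T"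
      by (intro norm_compose_right mult_right B_bounded T F)
    also have "nI ((K o\<^sub>L B l) o\<^sub>L ?C) \<le> norm (K o\<^sub>L B l) * nI ?C"
      by (intro norm_compose_left bounded_ops_compose commutator_mem B_bounded T K')
    also have "\<dots> \<le> norm (K o\<^sub>L B l) * M" by (intro mult_left_mono M) simp
    finally show ?thesis using l by simp
  qed
  moreover have "?g \<longlonglongrightarrow> 0"
    by (intro tendsto_add_zero tendsto_mult_left_zero B_ideal_right mult_right T F)
  ultimately show "\<exists>g. g \<longlonglongrightarrow> 0 \<and> (\<forall>m. nI (K o\<^sub>L commutator (A m) T) \<le> e + g m)"
    by blast
qed

lemma commutator_uminus: "commutator X Y = - commutator Y X"
  by (simp add: commutator_def)

lemma commutator_B_left:
  assumes T: "T \<in> bounded_ops" and K: "K \<in> compact_ops" and KT: "commutator K T \<in> I"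
    and M: "\<And>m. nI (commutator (A m) T) \<le> M"
  shows "(\<lambda>m. nI (commutator T (B m o\<^sub>L K))) \<longlonglongrightarrow> 0"
    and "commutator T (B m o\<^sub>L K) \<in> I"
proof -
  have K': "K \<in> bounded_ops" using K by (simp add: compact_ops_def)
  \<comment> \<open>\<open>E_algebra\<close> and \<open>E_norm\<close> order their commutators
    oppositely, so a sign change is needed.\<close>
  have TK: "commutator T K \<in> I" using uminus[OF KT] by (simp add: commutator_uminus[of T])
  \<comment> \<open>Leibniz rule for the commutator with a product, together with
    \<open>[T, B m] = [A m, T]\<close>.\<close>
  have eq: "commutator T (B m o\<^sub>L K) = (B m o\<^sub>L commutator T K) + (commutator (A m) T o\<^sub>L K)" for m
    by (rule blinfun_eqI)
      (simp add: B_def commutator_def blinfun.diff_left blinfun.diff_right blinfun.add_left)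
  show mem: "commutator T (B m o\<^sub>L K) \<in> I" for m
    unfolding eq
    by (intro add mult_left[OF _ TK] mult_right[OF commutator_mem] B_bounded T K')
  have le: "nI (commutator T (B m o\<^sub>L K)) \<le> nI (B m o\<^sub>L commutator T K) + nI (commutator (A m) T o\<^sub>L K)"
    for m unfolding eq
    by (intro norm_triangle mult_left[OF _ TK] mult_right[OF commutator_mem] B_bounded T K')
  have lim: "(\<lambda>m. nI (B m o\<^sub>L commutator T K) + nI (commutator (A m) T o\<^sub>L K)) \<longlonglongrightarrow> 0"
    by (intro tendsto_add_zero B_ideal_left TK commutator_compact_left[OF T K M])
  show "(\<lambda>m. nI (commutator T (B m o\<^sub>L K))) \<longlonglongrightarrow> 0"
    by (rule Lim_null_comparison[OF always_eventually lim]) (simp add: mem norm_nonneg le)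
qed

lemma commutator_B_right:
  assumes T: "T \<in> bounded_ops" and K: "K \<in> compact_ops" and KT: "commutator K T \<in> I"
    and M: "\<And>m. nI (commutator (A m) T) \<le> M"
  shows "(\<lambda>m. nI (commutator T (K o\<^sub>L B m))) \<longlonglongrightarrow> 0"
    and "commutator T (K o\<^sub>L B m) \<in> I"
proof -
  have K': "K \<in> bounded_ops" using K by (simp add: compact_ops_def)
  have TK: "commutator T K \<in> I" using uminus[OF KT] by (simp add: commutator_uminus[of T])
  have eq: "commutator T (K o\<^sub>L B m) = (commutator T K o\<^sub>L B m) + (K o\<^sub>L commutator (A m) T)" for m
    by (rule blinfun_eqI)
      (simp add: B_def commutator_def blinfun.diff_left blinfun.diff_right blinfun.add_left)
  show mem: "commutator T (K o\<^sub>L B m) \<in> I" for m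
    unfolding eq
    by (intro add mult_left[OF _ commutator_mem] mult_right[OF TK] B_bounded T K')
  have le: "nI (commutator T (K o\<^sub>L B m)) \<le> nI (commutator T K o\<^sub>L B m) + nI (K o\<^sub>L commutator (A m) T)"
    for m unfolding eq
    by (intro norm_triangle mult_left[OF _ commutator_mem] mult_right[OF TK] B_bounded T K')
  have lim: "(\<lambda>m. nI (commutator T K o\<^sub>L B m) + nI (K o\<^sub>L commutator (A m) T)) \<longlonglongrightarrow> 0"
    by (intro tendsto_add_zero B_ideal_right TK commutator_compact_right[OF T K M])
  show "(\<lambda>m. nI (commutator T (K o\<^sub>L B m))) \<longlonglongrightarrow> 0"
    by (rule Lim_null_comparison[OF always_eventually lim]) (simp add: mem norm_nonneg le)
qed

text \<open>The norms are at most 1, and strong convergence at a single nonzero vector forces them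
  up to 1 in the limit.\<close>

lemma norm_A_tendsto: "(\<lambda>m. norm (A m)) \<longlonglongrightarrow> 1"
proof -
  obtain x :: 'a where x: "x \<noteq> 0"
    using nonzero by (metis blinfun_eqI blinfun.zero_right zero_blinfun.rep_eq)
  have "(\<lambda>m. norm (A m x) / norm x) \<longlonglongrightarrow> norm x / norm x"
    using x by (intro tendsto_intros strong) auto
  then have lim: "(\<lambda>m. norm (A m x) / norm x) \<longlonglongrightarrow> 1" using x by simp
  have "norm (A m x) / norm x \<le> norm (A m)" for m
    using x norm_blinfun[of "A m" x] by (simp add: divide_le_eq)
  then show ?thesis
    by (intro tendsto_sandwich[OF _ _ lim tendsto_const] always_eventually allI norm_A_le)
qed

end

section \<open>The maximum over the tuple and the final limits\<close>

lemma tendsto_Max_zero: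
  fixes f :: "'i \<Rightarrow> nat \<Rightarrow> real"
  assumes J: "finite J" "J \<noteq> {}"
    and nonneg: "\<And>j m. j \<in> J \<Longrightarrow> 0 \<le> f j m"
    and lim: "\<And>j. j \<in> J \<Longrightarrow> f j \<longlonglongrightarrow> 0"
  shows "(\<lambda>m. MAX j\<in>J. f j m) \<longlonglongrightarrow> 0"
proof (rule tendsto_sandwich[OF _ _ tendsto_const])
  show "(\<lambda>m. \<Sum>j\<in>J. f j m) \<longlonglongrightarrow> 0" by (intro tendsto_null_sum lim)
  show "eventually (\<lambda>m. 0 \<le> (MAX j\<in>J. f j m)) sequentially"
    using J nonneg by (intro always_eventually allI) (auto simp: Max_ge_iff)
  show "eventually (\<lambda>m. (MAX j\<in>J. f j m) \<le> (\<Sum>j\<in>J. f j m)) sequentially"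
    using J nonneg by (intro always_eventually allI) (auto intro!: member_le_sum)
qed

theorem proposition5p1:
  fixes T :: "nat \<Rightarrow> ('a::complex_hilbert_space \<Rightarrow>\<^sub>L 'a)"
    and n :: nat
    and I :: "('a \<Rightarrow>\<^sub>L 'a) set"
    and nI :: "('a \<Rightarrow>\<^sub>L 'a) \<Rightarrow> real"
    and C :: real
    and A :: "nat \<Rightarrow> ('a \<Rightarrow>\<^sub>L 'a)"
  assumes "separable_space (euclidean :: 'a topology)"
    and "infinite_dimensional TYPE('a)"
    and "1 \<le> n"
    and "\<And>j. j \<in> {1..n} \<Longrightarrow> hermitian (T j)"
    and "normed_ideal I nI"
    and "finite_rank_dense I nI"
    and "quasicentral_modulus nI n T = ereal C"
    and "\<And>m. A m \<in> R1_plus"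
    and "increases_strongly_to_id A"
    and "(\<lambda>m. commutator_norm nI n T (A m)) \<longlonglongrightarrow> C"
  shows "(\<lambda>m. E_norm nI n T (A m)) \<longlonglongrightarrow> 1 + C \<and>
    (\<forall>K \<in> K_algebra I n T.
      (\<lambda>m. E_norm nI n T (K - (A m o\<^sub>L K))) \<longlonglongrightarrow> 0 \<and>
      (\<lambda>m. E_norm nI n T (K - (K o\<^sub>L A m))) \<longlonglongrightarrow> 0)"
proof -
  interpret ideal_approximate_unit I nI A
    using assms(5,6,8,9)
    by (simp add: ideal_approximate_unit_def ideal_approximate_unit_axioms_def
        increases_strongly_to_id_def)
  have T: "T j \<in> bounded_ops" if "j \<in> {1..n}" for j
    using assms(4)[OF that] by (simp add: hermitian_def)
  \<comment> \<open>Nonemptiness of the index set makes each \<open>Max\<close> an actual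
    maximum.\<close>
  have J: "finite {1..n}" "{1..n} \<noteq> {}" using assms(3) by auto
  have E_eq: "E_norm nI n T (A m) = norm (A m) + commutator_norm nI n T (A m)" for m
  proof -
    have "nI (commutator (T j) (A m)) = nI (commutator (A m) (T j))" if "j \<in> {1..n}" for j
      by (subst commutator_uminus) (rule norm_uminus[OF commutator_mem[OF T[OF that]]])
    then show ?thesis
      unfolding E_norm_def commutator_norm_def by (simp cong: image_cong_simp)
  qed
  \<comment> \<open>A convergent sequence is bounded; this supplies one bound for all
    \<open>m\<close> and \<open>j\<close>, as the commutator lemmas require.\<close>
  obtain M where "\<And>m. norm (commutator_norm nI n T (A m)) \<le> M"
    using assms(10) by (metis BseqE convergentI convergent_imp_Bseq)
  then have "commutator_norm nI n T (A m) \<le> M" for m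
    by (metis abs_le_D1 real_norm_def)
  then have M: "nI (commutator (A m) (T j)) \<le> M" if "j \<in> {1..n}" for j m
    using J that unfolding commutator_norm_def by (auto simp: Max_le_iff)
  have "(\<lambda>m. E_norm nI n T (K - (A m o\<^sub>L K))) \<longlonglongrightarrow> 0 \<and>
      (\<lambda>m. E_norm nI n T (K - (K o\<^sub>L A m))) \<longlonglongrightarrow> 0" if "K \<in> K_algebra I n T" for K
  proof
    have K: "K \<in> compact_ops" "\<And>j. j \<in> {1..n} \<Longrightarrow> commutator K (T j) \<in> I"
      using that by (auto simp: K_algebra_def E_algebra_def)
    have eq: "K - (A m o\<^sub>L K) = B m o\<^sub>L K" "K - (K o\<^sub>L A m) = K o\<^sub>L B m" for m
      by (rule blinfun_eqI, simp add: B_def blinfun.diff_left blinfun.diff_right)+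
    show "(\<lambda>m. E_norm nI n T (K - (A m o\<^sub>L K))) \<longlonglongrightarrow> 0"
      unfolding E_norm_def eq
      by (intro tendsto_add_zero B_compact_left tendsto_Max_zero J K norm_nonneg
          commutator_B_left[where M = M] T M)
    show "(\<lambda>m. E_norm nI n T (K - (K o\<^sub>L A m))) \<longlonglongrightarrow> 0"
      unfolding E_norm_def eq
      by (intro tendsto_add_zero B_compact_right tendsto_Max_zero J K norm_nonneg
          commutator_B_right[where M = M] T M)
  qed
  then show ?thesis
    unfolding E_eq using tendsto_add[OF norm_A_tendsto assms(10)] by blast
qed

end
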